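(* (AMDCT V) Let $n,N$ be positive integers. For all $k,k'\in D_N^-$, $$\sum_{s\in F_N^{\mathrm{V},-}}\varepsilon_s\cos_k^-(s)\cos_{k'}^-(s)=d_k^{-1}\left(\frac{2N-1}{4}\right)^n\delta_{kk'}.$$ Consequently any function $f:F_N^{\mathrm{V},-}\to\mathbb{R}$ can be expanded, for all $s\in F_N^{\mathrm{V},-}$, as $$f(s)=\sum_{k\in D_N^-}A_k\cos^-_k(s)\quad\text{with}\quad A_k=d_k\left(\frac{4}{2N-1}\right)^n\sum_{s\in F_N^{\mathrm{V},-}}\varepsilon_s f(s)\cos_k^-(s).$$
   Context: For $\lambda,x\in\mathbb{R}^n$, the antisymmetric cosine function is $\cos^-_\lambda(x)=\sum_{\sigma\in S_n}\mathrm{sgn}(\sigma)\prod_{i=1}^n\cos(\pi\lambda_{\sigma(i)}x_i)$. For fixed $N$, put $c_r=\frac12$ if $r=0$ or $r=N$, and $c_r=1$ otherwise. Let $D_N=\{(k_1,\dots,k_n)\in\mathbb{Z}^n : 0\le k_i\le N-1,\ i=1,\dots,n\}$ and $D_N^-=\{k\in D_N : k_1>k_2>\dots>k_n\}$. For $k\in D_N$, $d_k=c_{k_1}\cdots c_{k_n}$. The grid is $F_N^{\mathrm{V},-}=\left\{\left(\frac{2r_1}{2N-1},\dots,\frac{2r_n}{2N-1}\right) : (r_1,\dots,r_n)\in D_N^-\right\}$, and for $s=\left(\frac{2r_1}{2N-1},\dots,\frac{2r_n}{2N-1}\right)$ in it, $\varepsilon_s=c_{r_1}\cdots c_{r_n}$.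 *)

theory Defs
  imports Complex_Main "HOL-Library.FuncSet" "HOL-Combinatorics.Permutations"
begin

text \<open>Points of \<open>\<int>\<^sup>n\<close> and \<open>\<real>\<^sup>n\<close> are functions on the index set \<open>{1..n}\<close>. The members of the
  finite sets below are extensional, so that equality of functions is equality of points.\<close>

definition antisym_cos :: "nat \<Rightarrow> (nat \<Rightarrow> real) \<Rightarrow> (nat \<Rightarrow> real) \<Rightarrow> real" where
  "antisym_cos n l x =
     (\<Sum>\<sigma> | \<sigma> permutes {1..n}. of_int (sign \<sigma>) * (\<Prod>i\<in>{1..n}. cos (pi * l (\<sigma> i) * x i)))"

definition c_coeff :: "nat \<Rightarrow> int \<Rightarrow> real" where
  "c_coeff N r = (if r = 0 \<or> r = int N then 1/2 else 1)"

definition D_set :: "nat \<Rightarrow> nat \<Rightarrow> (nat \<Rightarrow> int) set" where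
  "D_set n N = {1..n} \<rightarrow>\<^sub>E {0..int N - 1}"

definition D_minus :: "nat \<Rightarrow> nat \<Rightarrow> (nat \<Rightarrow> int) set" where
  "D_minus n N = {k \<in> D_set n N. strict_antimono_on {1..n} k}"

definition d_coeff :: "nat \<Rightarrow> nat \<Rightarrow> (nat \<Rightarrow> int) \<Rightarrow> real" where
  "d_coeff n N k = (\<Prod>i\<in>{1..n}. c_coeff N (k i))"

definition grid_point :: "nat \<Rightarrow> nat \<Rightarrow> (nat \<Rightarrow> int) \<Rightarrow> nat \<Rightarrow> real" where
  "grid_point n N r = (\<lambda>i\<in>{1..n}. 2 * of_int (r i) / (2 * real N - 1))"

definition F_grid :: "nat \<Rightarrow> nat \<Rightarrow> (nat \<Rightarrow> real) set" where
  "F_grid n N = grid_point n N ` D_minus n N"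

text \<open>The weight of a grid point is read off from its label \<open>r\<close>, which is unique; the
  characteristic equation is \<open>grid_weight_grid_point\<close>.\<close>

definition grid_weight :: "nat \<Rightarrow> nat \<Rightarrow> (nat \<Rightarrow> real) \<Rightarrow> real" where
  "grid_weight n N s =
     (\<Prod>i\<in>{1..n}. c_coeff N (the_inv_into (D_minus n N) (grid_point n N) s i))"

lemma inj_on_grid_point: "inj_on (grid_point n N) (D_minus n N)"
proof (rule inj_onI)
  fix r r' assume r: "r \<in> D_minus n N" and r': "r' \<in> D_minus n N"
    and eq: "grid_point n N r = grid_point n N r'"
  have nz: "2 * real N - 1 \<noteq> 0"
  proof
    assume "2 * real N - 1 = 0"
    then have "real (2 * N) = real 1" by simp
    then have "2 * N = 1" by (simp only: of_nat_eq_iff)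
    then show False by presburger
  qed
  show "r = r'"
  proof (rule PiE_ext)
    show "r \<in> {1..n} \<rightarrow>\<^sub>E {0..int N - 1}" "r' \<in> {1..n} \<rightarrow>\<^sub>E {0..int N - 1}"
      using r r' by (auto simp: D_minus_def D_set_def)
    fix i assume "i \<in> {1..n}"
    then show "r i = r' i"
      using fun_cong[OF eq, of i] nz by (simp add: grid_point_def)
  qed
qed

lemma grid_weight_grid_point:
  assumes "r \<in> D_minus n N"
  shows "grid_weight n N (grid_point n N r) = (\<Prod>i\<in>{1..n}. c_coeff N (r i))"
  using assms by (simp add: grid_weight_def the_inv_into_f_f[OF inj_on_grid_point])

end

theory Submission
  imports Defs
begin

text \<open>
  Write \<open>M = 2N - 1\<close>. On labels, \<open>antisym_cos\<close> is the determinant of the matrix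
  \<open>cos (2 \<pi> k\<^sub>i r\<^sub>j / M)\<close>, so the statement is an antisymmetrised form of a one-dimensional
  discrete cosine transform.

  In dimension one (\<open>cos_kernel_orthogonality\<close>), the product of two cosines is half the sum of the
  cosines with frequencies \<open>a - b\<close> and \<open>a + b\<close>, both smaller than \<open>M\<close> in absolute value. The weighted
  sum of \<open>cos (2 \<pi> m r / M)\<close> over \<open>0 \<le> r < N\<close> is half its sum over a full period, thus \<open>M / 2\<close> or \<open>0\<close>
  according to whether \<open>M\<close> divides \<open>m\<close>; it is evaluated here as a Dirichlet kernel at a zero of
  its numerator.

  The passage to dimension \<open>n\<close> (\<open>alternant_orthogonality\<close>) is the discrete Andreief identity and
  works for every kernel. Expanding one determinant over permutations and letting these act on the
  decreasing labels turns the sum into one over all injective labels; the other determinant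
  absorbs the sign. As it vanishes on non-injective labels, the sum extends to the whole product
  set, where it factors into one-dimensional sums. These force \<open>k = k' \<circ> \<tau>\<close>, which for decreasing
  \<open>k\<close> and \<open>k'\<close> leaves only \<open>\<tau> = id\<close> and \<open>k = k'\<close>.

  For the expansion, the kernel is symmetric in label and frequency, so the determinants are too.
  Interchanging the two finite sums in the expansion therefore leaves an inner sum which is the
  same orthogonality relation with the roles of \<open>k\<close> and \<open>r\<close> exchanged.
\<close>

section \<open>Decreasing representatives of injective labels\<close>

definition decreasing_labels :: "nat \<Rightarrow> 'a::linorder set \<Rightarrow> (nat \<Rightarrow> 'a) set" where
  "decreasing_labels n A = {k \<in> {1..n} \<rightarrow>\<^sub>E A. strict_antimono_on {1..n} k}"

text \<open>The position of \<open>k i\<close> in the decreasing arrangement of the entries. Off \<open>{1..n}\<close> the value is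
  \<open>i\<close>, so that the rank of an injective label is a permutation in the sense of \<open>permutes\<close>.\<close>

definition rank :: "nat \<Rightarrow> (nat \<Rightarrow> 'a::linorder) \<Rightarrow> nat \<Rightarrow> nat" where
  "rank n k i = (if i \<in> {1..n} then card {j \<in> {1..n}. k i \<le> k j} else i)"

lemma decreasing_labels_inj_on:
  assumes "k \<in> decreasing_labels n A"
  shows "inj_on k {1..n}"
  using assms by (auto simp: decreasing_labels_def strict_antimono_iff_antimono)

lemma rank_decreasing:
  assumes "k \<in> decreasing_labels n A"
  shows "rank n k i = i"
proof (cases "i \<in> {1..n}")
  case True
  have dec: "k b < k a" if "a \<in> {1..n}" "b \<in> {1..n}" "a < b" for a b
    using assms that by (auto simp: decreasing_labels_def monotone_on_def)
  have "{j \<in> {1..n}. k i \<le> k j} = {1..i}"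
  proof (intro set_eqI iffI)
    fix j assume "j \<in> {j \<in> {1..n}. k i \<le> k j}"
    then show "j \<in> {1..i}" using dec[of i j] True by (cases "i < j") auto
  next
    fix j assume "j \<in> {1..i}"
    then show "j \<in> {j \<in> {1..n}. k i \<le> k j}"
      using dec[of j i] True by (cases "j = i") auto
  qed
  then show ?thesis using True by (simp add: rank_def)
qed (auto simp: rank_def)

lemma rank_comp_permutation:
  assumes \<tau>: "\<tau> permutes {1..n}"
  shows "rank n (k \<circ> \<tau>) i = rank n k (\<tau> i)"
proof (cases "i \<in> {1..n}")
  case True
  have "bij_betw \<tau> {j \<in> {1..n}. k (\<tau> i) \<le> k (\<tau> j)} {j \<in> {1..n}. k (\<tau> i) \<le> k j}"
  proof (rule bij_betw_imageI)
    show "inj_on \<tau> {j \<in> {1..n}. k (\<tau> i) \<le> k (\<tau> j)}"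
      using permutes_inj_on[OF \<tau>] .
    show "\<tau> ` {j \<in> {1..n}. k (\<tau> i) \<le> k (\<tau> j)} = {j \<in> {1..n}. k (\<tau> i) \<le> k j}"
    proof (intro equalityI subsetI)
      fix l assume l: "l \<in> {j \<in> {1..n}. k (\<tau> i) \<le> k j}"
      then obtain j where "j \<in> {1..n}" "l = \<tau> j" using permutes_image[OF \<tau>] by blast
      with l show "l \<in> \<tau> ` {j \<in> {1..n}. k (\<tau> i) \<le> k (\<tau> j)}" by blast
    qed (use permutes_in_image[OF \<tau>] in blast)
  qed
  then show ?thesis
    using True permutes_in_image[OF \<tau>, of i] by (simp add: rank_def bij_betw_same_card)
next
  case False
  then show ?thesis
    using permutes_not_in[OF \<tau> False] by (auto simp: rank_def)
qed

text \<open>The rank of a permuted label is the permuted rank, while a decreasing label has the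
  identity as its rank; hence the only permutation between decreasing labels is the identity.\<close>

lemma decreasing_labels_permuted_unique:
  assumes k: "k \<in> decreasing_labels n A" and k': "k' \<in> decreasing_labels n A"
    and \<tau>: "\<tau> permutes {1..n}" and eq: "\<And>i. i \<in> {1..n} \<Longrightarrow> k i = k' (\<tau> i)"
  shows "\<tau> = id \<and> k = k'"
proof -
  have keq: "k = k' \<circ> \<tau>"
  proof
    fix i show "k i = (k' \<circ> \<tau>) i"
    proof (cases "i \<in> {1..n}")
      case False
      have "k i = undefined" "k' i = undefined"
        using k k' False unfolding decreasing_labels_def by (blast intro: PiE_arb)+
      then show ?thesis using permutes_not_in[OF \<tau> False] by simp
    qed (simp add: eq)
  qed
  have "\<tau> i = i" for i
    using rank_decreasing[OF k, of i] rank_decreasing[OF k', of "\<tau> i"]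
      rank_comp_permutation[OF \<tau>, of k' i] keq by simp
  then have "\<tau> = id" by auto
  with keq show ?thesis by simp
qed

lemma rank_strict:
  assumes "i \<in> {1..n}" "j \<in> {1..n}" "k j < k i"
  shows "rank n k i < rank n k j"
proof -
  have "{l \<in> {1..n}. k i \<le> k l} \<subset> {l \<in> {1..n}. k j \<le> k l}"
  proof (rule psubsetI)
    show "{l \<in> {1..n}. k i \<le> k l} \<subseteq> {l \<in> {1..n}. k j \<le> k l}"
      using assms(3) by auto
    have "j \<in> {l \<in> {1..n}. k j \<le> k l}" "j \<notin> {l \<in> {1..n}. k i \<le> k l}"
      using assms by auto
    then show "{l \<in> {1..n}. k i \<le> k l} \<noteq> {l \<in> {1..n}. k j \<le> k l}" by blast
  qed
  then show ?thesis using assms by (simp add: rank_def psubset_card_mono)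
qed

lemma rank_permutes:
  assumes inj: "inj_on k {1..n}"
  shows "rank n k permutes {1..n}"
proof (rule inj_imp_permutes)
  show "inj_on (rank n k) {1..n}"
  proof (rule inj_onI)
    fix i j assume "i \<in> {1..n}" "j \<in> {1..n}" "rank n k i = rank n k j"
    then show "i = j"
      using rank_strict[of i n j k] rank_strict[of j n i k] inj
      by (metis inj_onD less_irrefl linorder_neqE)
  qed
  show "rank n k i \<in> {1..n}" if i: "i \<in> {1..n}" for i
  proof -
    have "i \<in> {j \<in> {1..n}. k i \<le> k j}" using i by simp
    then have "card {j \<in> {1..n}. k i \<le> k j} > 0" by (subst card_gt_0_iff) auto
    moreover have "card {j \<in> {1..n}. k i \<le> k j} \<le> card {1..n}" by (rule card_mono) auto
    ultimately show ?thesis using i by (simp add: rank_def)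
  qed
qed (auto simp: rank_def)

lemma comp_permutation_PiE:
  assumes r: "r \<in> I \<rightarrow>\<^sub>E A" and \<sigma>: "\<sigma> permutes I"
  shows "r \<circ> \<sigma> \<in> I \<rightarrow>\<^sub>E A"
proof (rule PiE_I)
  show "(r \<circ> \<sigma>) i \<in> A" if "i \<in> I" for i
    using r permutes_in_image[OF \<sigma>, of i] that by (auto intro: PiE_mem)
  show "(r \<circ> \<sigma>) i = undefined" if "i \<notin> I" for i
    using r permutes_not_in[OF \<sigma> that] that by (auto intro: PiE_arb)
qed

text \<open>Sorting. Rearranging an injective label by the inverse of its rank makes it decreasing, and
  \<open>decreasing_labels_permuted_unique\<close> rules out a second way to obtain it.\<close>

lemma bij_betw_permuted_decreasing:
  "bij_betw (\<lambda>(r, \<sigma>). r \<circ> \<sigma>) (decreasing_labels n A \<times> {\<sigma>. \<sigma> permutes {1..n}})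
     {r \<in> {1..n} \<rightarrow>\<^sub>E A. inj_on r {1..n}}"
  (is "bij_betw ?h ?X ?Y")
proof (rule bij_betw_imageI)
  show "inj_on ?h ?X"
  proof (rule inj_onI, clarsimp)
    fix r \<sigma> r' \<sigma>'
    assume r: "r \<in> decreasing_labels n A" and r': "r' \<in> decreasing_labels n A"
      and \<sigma>: "\<sigma> permutes {Suc 0..n}" and \<sigma>': "\<sigma>' permutes {Suc 0..n}" and eq: "r \<circ> \<sigma> = r' \<circ> \<sigma>'"
    have \<tau>: "\<sigma>' \<circ> inv \<sigma> permutes {1..n}"
      using \<sigma> \<sigma>' by (simp add: permutes_compose permutes_inv)
    have "r i = r' ((\<sigma>' \<circ> inv \<sigma>) i)" for i
      using fun_cong[OF eq, of "inv \<sigma> i"] permutes_inverses(1)[OF \<sigma>] by simp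
    then have "\<sigma>' \<circ> inv \<sigma> = id \<and> r = r'"
      by (intro decreasing_labels_permuted_unique[OF r r' \<tau>])
    moreover from this have "\<sigma>' = \<sigma>"
      using permutes_inv_o(2)[OF \<sigma>] by (metis comp_id fun.map_comp id_comp)
    ultimately show "r = r' \<and> \<sigma> = \<sigma>'" by simp
  qed
  show "?h ` ?X = ?Y"
  proof (intro equalityI subsetI)
    fix x assume "x \<in> ?h ` ?X"
    then obtain r \<sigma> where r: "r \<in> decreasing_labels n A" and \<sigma>: "\<sigma> permutes {1..n}"
      and x: "x = r \<circ> \<sigma>" by auto
    have "x \<in> {1..n} \<rightarrow>\<^sub>E A"
      unfolding x using r \<sigma> by (intro comp_permutation_PiE) (auto simp: decreasing_labels_def)
    moreover have "inj_on x {1..n}"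
      unfolding x using decreasing_labels_inj_on[OF r] permutes_image[OF \<sigma>]
      by (intro comp_inj_on permutes_inj_on[OF \<sigma>]) simp
    ultimately show "x \<in> ?Y" by simp
  next
    fix x assume x: "x \<in> ?Y"
    define \<rho> where "\<rho> = rank n x"
    have \<rho>: "\<rho> permutes {1..n}" unfolding \<rho>_def using x by (intro rank_permutes) simp
    let ?r = "x \<circ> inv \<rho>"
    have "?r \<in> {1..n} \<rightarrow>\<^sub>E A"
      using x permutes_inv[OF \<rho>] by (intro comp_permutation_PiE) auto
    moreover have "?r j < ?r i" if ij: "i \<in> {1..n}" "j \<in> {1..n}" "i < j" for i j
    proof (rule ccontr)
      assume "\<not> ?r j < ?r i"
      moreover have mem: "inv \<rho> i \<in> {1..n}" "inv \<rho> j \<in> {1..n}"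
        using ij permutes_in_image[OF permutes_inv[OF \<rho>]] by blast+
      moreover have "inv \<rho> i \<noteq> inv \<rho> j"
        using ij permutes_inv_eq[OF \<rho>] by (metis less_irrefl)
      then have "?r i \<noteq> ?r j" using x mem by (auto dest: inj_onD)
      ultimately have "rank n x (inv \<rho> j) < rank n x (inv \<rho> i)"
        by (intro rank_strict) auto
      then show False using ij permutes_inverses(1)[OF \<rho>] by (simp add: \<rho>_def)
    qed
    ultimately have "?r \<in> decreasing_labels n A"
      by (auto simp: decreasing_labels_def monotone_on_def)
    moreover have "x = ?r \<circ> \<rho>" using permutes_inverses(2)[OF \<rho>] by auto
    ultimately show "x \<in> ?h ` ?X" using \<rho> by (auto intro!: rev_image_eqI[of "(?r, \<rho>)"])
  qed
qed

lemma sum_permuted_decreasing: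
  fixes g :: "(nat \<Rightarrow> 'a::linorder) \<Rightarrow> 'b::comm_monoid_add"
  shows "(\<Sum>r\<in>decreasing_labels n A. \<Sum>\<sigma> | \<sigma> permutes {1..n}. g (r \<circ> \<sigma>)) =
    (\<Sum>r | r \<in> {1..n} \<rightarrow>\<^sub>E A \<and> inj_on r {1..n}. g r)"
  using sum.reindex_bij_betw[OF bij_betw_permuted_decreasing, of g n A]
  by (simp add: sum.cartesian_product case_prod_unfold)

section \<open>Orthogonality of alternants\<close>

text \<open>This is the determinant of the matrix with entries \<open>C (k i) (r j)\<close>, by the Leibniz formula.\<close>

definition alternant :: "nat \<Rightarrow> ('a \<Rightarrow> 'b \<Rightarrow> real) \<Rightarrow> (nat \<Rightarrow> 'a) \<Rightarrow> (nat \<Rightarrow> 'b) \<Rightarrow> real" where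
  "alternant n C k r =
     (\<Sum>\<sigma> | \<sigma> permutes {1..n}. of_int (sign \<sigma>) * (\<Prod>i\<in>{1..n}. C (k (\<sigma> i)) (r i)))"

lemma permutes_sign_inv:
  assumes "\<sigma> permutes {1..n::nat}"
  shows "sign (inv \<sigma>) = sign \<sigma>"
  using assms by (intro sign_inverse) (auto simp: permutation_permutes)

lemma permutes_sign_comp:
  assumes "\<sigma> permutes {1..n::nat}" "\<tau> permutes {1..n}"
  shows "sign (\<sigma> \<circ> \<tau>) = sign \<sigma> * sign \<tau>"
  using assms by (intro sign_compose) (auto simp: permutation_permutes)

text \<open>A matrix and its transpose have the same determinant.\<close>

lemma alternant_transpose:
  "alternant n C k r =
     (\<Sum>\<sigma> | \<sigma> permutes {1..n}. of_int (sign \<sigma>) * (\<Prod>i\<in>{1..n}. C (k i) (r (\<sigma> i))))"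
proof -
  have "alternant n C k r =
    (\<Sum>\<sigma> | \<sigma> permutes {1..n}. of_int (sign (inv \<sigma>)) * (\<Prod>i\<in>{1..n}. C (k (inv \<sigma> i)) (r i)))"
    unfolding alternant_def by (rule sum_permutations_inverse)
  also have "\<dots> = (\<Sum>\<sigma> | \<sigma> permutes {1..n}. of_int (sign \<sigma>) * (\<Prod>i\<in>{1..n}. C (k i) (r (\<sigma> i))))"
  proof (rule sum.cong[OF refl])
    fix \<sigma> assume "\<sigma> \<in> {\<sigma>. \<sigma> permutes {1..n}}"
    then have \<sigma>: "\<sigma> permutes {1..n}" by simp
    have "(\<Prod>i\<in>{1..n}. C (k (inv \<sigma> i)) (r i)) = (\<Prod>i\<in>{1..n}. C (k i) (r (\<sigma> i)))"
      by (subst prod.permute[OF \<sigma>]) (simp add: permutes_inverses(2)[OF \<sigma>])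
    then show "of_int (sign (inv \<sigma>)) * (\<Prod>i\<in>{1..n}. C (k (inv \<sigma> i)) (r i)) =
        of_int (sign \<sigma>) * (\<Prod>i\<in>{1..n}. C (k i) (r (\<sigma> i)))"
      by (simp add: permutes_sign_inv[OF \<sigma>])
  qed
  finally show ?thesis .
qed

lemma alternant_permuted:
  assumes \<tau>: "\<tau> permutes {1..n}"
  shows "alternant n C k (r \<circ> \<tau>) = of_int (sign \<tau>) * alternant n C k r"
proof -
  have "alternant n C k (r \<circ> \<tau>) =
    (\<Sum>\<sigma> | \<sigma> permutes {1..n}. of_int (sign (\<sigma> \<circ> \<tau>)) * (\<Prod>i\<in>{1..n}. C (k ((\<sigma> \<circ> \<tau>) i)) ((r \<circ> \<tau>) i)))"
    unfolding alternant_def by (rule sum_permutations_compose_right[OF \<tau>])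
  also have "\<dots> = (\<Sum>\<sigma> | \<sigma> permutes {1..n}.
      of_int (sign \<tau>) * (of_int (sign \<sigma>) * (\<Prod>i\<in>{1..n}. C (k (\<sigma> i)) (r i))))"
  proof (rule sum.cong[OF refl])
    fix \<sigma> assume "\<sigma> \<in> {\<sigma>. \<sigma> permutes {1..n}}"
    then have \<sigma>: "\<sigma> permutes {1..n}" by simp
    have "(\<Prod>i\<in>{1..n}. C (k (\<sigma> i)) (r i)) = (\<Prod>i\<in>{1..n}. C (k ((\<sigma> \<circ> \<tau>) i)) ((r \<circ> \<tau>) i))"
      by (subst prod.permute[OF \<tau>]) simp
    then show "of_int (sign (\<sigma> \<circ> \<tau>)) * (\<Prod>i\<in>{1..n}. C (k ((\<sigma> \<circ> \<tau>) i)) ((r \<circ> \<tau>) i)) =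
        of_int (sign \<tau>) * (of_int (sign \<sigma>) * (\<Prod>i\<in>{1..n}. C (k (\<sigma> i)) (r i)))"
      by (simp add: permutes_sign_comp[OF \<sigma> \<tau>] ac_simps)
  qed
  finally show ?thesis by (simp add: alternant_def sum_distrib_left)
qed

text \<open>A transposition of two equal entries fixes the label but reverses the sign.\<close>

lemma alternant_not_inj:
  assumes "\<not> inj_on r {1..n}"
  shows "alternant n C k r = 0"
proof -
  obtain i j where ij: "i \<in> {1..n}" "j \<in> {1..n}" "i \<noteq> j" "r i = r j"
    using assms by (auto simp: inj_on_def)
  have "r \<circ> transpose i j = r"
    using ij by (auto simp: transpose_def)
  then have "alternant n C k r = - alternant n C k r"
    using alternant_permuted[OF permutes_swap_id[OF ij(1,2)], of C k r] ij(3)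
    by (simp add: sign_swap_id)
  then show ?thesis by simp
qed

text \<open>Discrete Andreief identity: the orthogonality of one-variable functions \<open>C a\<close> under the weight
  \<open>w\<close> passes to their alternants.\<close>

lemma alternant_orthogonality:
  fixes A :: "'b::linorder set" and B :: "'a::linorder set" and C :: "'a \<Rightarrow> 'b \<Rightarrow> real"
  assumes A: "finite A"
    and orth: "\<And>a b. a \<in> B \<Longrightarrow> b \<in> B \<Longrightarrow>
      (\<Sum>m\<in>A. w m * C a m * C b m) = (if a = b then h a else 0)"
    and k: "k \<in> decreasing_labels n B" and k': "k' \<in> decreasing_labels n B"
  shows "(\<Sum>r\<in>decreasing_labels n A.
      (\<Prod>i\<in>{1..n}. w (r i)) * alternant n C k r * alternant n C k' r) =
    (if k = k' then \<Prod>i\<in>{1..n}. h (k i) else 0)"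
proof -
  let ?P = "{\<sigma>. \<sigma> permutes {1..n}}"
  (* One determinant is replaced by its diagonal term: the other terms are the values of g at the
     permuted labels, since permuting r in the second determinant yields the matching sign. *)
  define g where "g = (\<lambda>r. (\<Prod>i\<in>{1..n}. w (r i)) * (\<Prod>i\<in>{1..n}. C (k i) (r i)) * alternant n C k' r)"
  have memB: "k i \<in> B" "k' i \<in> B" if "i \<in> {1..n}" for i
    using k k' that unfolding decreasing_labels_def by (blast intro: PiE_mem)+
  have "(\<Sum>r\<in>decreasing_labels n A.
      (\<Prod>i\<in>{1..n}. w (r i)) * alternant n C k r * alternant n C k' r) =
    (\<Sum>r\<in>decreasing_labels n A. \<Sum>\<sigma>\<in>?P. g (r \<circ> \<sigma>))"
  proof (rule sum.cong[OF refl])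
    fix r
    have "(\<Prod>i\<in>{1..n}. w (r i)) * alternant n C k r * alternant n C k' r =
      (\<Sum>\<sigma>\<in>?P. (\<Prod>i\<in>{1..n}. w (r i)) * (of_int (sign \<sigma>) * (\<Prod>i\<in>{1..n}. C (k i) (r (\<sigma> i))))
         * alternant n C k' r)"
      by (simp only: alternant_transpose[of n C k r] sum_distrib_left sum_distrib_right)
    also have "\<dots> = (\<Sum>\<sigma>\<in>?P. g (r \<circ> \<sigma>))"
    proof (rule sum.cong[OF refl])
      fix \<sigma> assume "\<sigma> \<in> ?P"
      then have \<sigma>: "\<sigma> permutes {1..n}" by simp
      show "(\<Prod>i\<in>{1..n}. w (r i)) * (of_int (sign \<sigma>) * (\<Prod>i\<in>{1..n}. C (k i) (r (\<sigma> i))))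
         * alternant n C k' r = g (r \<circ> \<sigma>)"
        using prod.permute[OF \<sigma>, of "\<lambda>i. w (r i)"]
        by (simp add: g_def alternant_permuted[OF \<sigma>])
    qed
    finally show "(\<Prod>i\<in>{1..n}. w (r i)) * alternant n C k r * alternant n C k' r =
      (\<Sum>\<sigma>\<in>?P. g (r \<circ> \<sigma>))" .
  qed
  also have "\<dots> = (\<Sum>r | r \<in> {1..n} \<rightarrow>\<^sub>E A \<and> inj_on r {1..n}. g r)"
    by (rule sum_permuted_decreasing)
  also have "\<dots> = (\<Sum>r\<in>{1..n} \<rightarrow>\<^sub>E A. g r)"
    by (rule sum.mono_neutral_left) (auto simp: A finite_PiE g_def alternant_not_inj)
  also have "\<dots> = (\<Sum>r\<in>{1..n} \<rightarrow>\<^sub>E A. \<Sum>\<tau>\<in>?P. of_int (sign \<tau>) *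
      (\<Prod>i\<in>{1..n}. w (r i) * C (k i) (r i) * C (k' (\<tau> i)) (r i)))"
    by (simp add: g_def alternant_def sum_distrib_left prod.distrib ac_simps)
  also have "\<dots> = (\<Sum>\<tau>\<in>?P. of_int (sign \<tau>) *
      (\<Sum>r\<in>{1..n} \<rightarrow>\<^sub>E A. \<Prod>i\<in>{1..n}. w (r i) * C (k i) (r i) * C (k' (\<tau> i)) (r i)))"
    by (subst sum.swap) (simp add: sum_distrib_left)
  also have "\<dots> = (\<Sum>\<tau>\<in>?P. of_int (sign \<tau>) *
      (\<Prod>i\<in>{1..n}. \<Sum>m\<in>A. w m * C (k i) m * C (k' (\<tau> i)) m))"
    by (simp add: prod_sum_PiE A)
  also have "\<dots> = (\<Sum>\<tau>\<in>?P. of_int (sign \<tau>) *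
      (\<Prod>i\<in>{1..n}. if k i = k' (\<tau> i) then h (k i) else 0))"
  proof (intro sum.cong[OF refl] arg_cong2[where f="(*)"] refl prod.cong)
    fix \<tau> i assume "\<tau> \<in> ?P" and i: "i \<in> {1..n}"
    then have "\<tau> i \<in> {1..n}" using permutes_in_image[of \<tau> "{1..n}" i] by blast
    then show "(\<Sum>m\<in>A. w m * C (k i) m * C (k' (\<tau> i)) m) = (if k i = k' (\<tau> i) then h (k i) else 0)"
      using i by (intro orth memB)
  qed
  also have "\<dots> = (\<Sum>\<tau>\<in>?P. if \<tau> = id then if k = k' then \<Prod>i\<in>{1..n}. h (k i) else 0 else 0)"
  proof (rule sum.cong[OF refl])
    fix \<tau> assume "\<tau> \<in> ?P"
    then have \<tau>: "\<tau> permutes {1..n}" by simp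
    show "of_int (sign \<tau>) * (\<Prod>i\<in>{1..n}. if k i = k' (\<tau> i) then h (k i) else 0) =
      (if \<tau> = id then if k = k' then \<Prod>i\<in>{1..n}. h (k i) else 0 else 0)"
    proof (cases "\<tau> = id \<and> k = k'")
      case True
      then show ?thesis by simp
    next
      case False
      then obtain i where "i \<in> {1..n}" "k i \<noteq> k' (\<tau> i)"
        using decreasing_labels_permuted_unique[OF k k' \<tau>] by blast
      then have "(\<Prod>i\<in>{1..n}. if k i = k' (\<tau> i) then h (k i) else 0) = 0"
        by (intro prod_zero) auto
      then show ?thesis using False by auto
    qed
  qed
  also have "\<dots> = (if k = k' then \<Prod>i\<in>{1..n}. h (k i) else 0)"
    by (simp add: sum.delta finite_permutations)
  finally show ?thesis .
qed

section \<open>The one-dimensional cosine transform\<close>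

text \<open>Multiplied by \<open>2 sin (x / 2)\<close>, the sum telescopes.\<close>

lemma dirichlet_kernel_sin:
  "2 * sin (x / 2) * (1 / 2 + (\<Sum>r\<in>{1..<Suc p}. cos (real r * x))) = sin ((real p + 1 / 2) * x)"
proof (induction p)
  case (Suc p)
  have "2 * sin (x / 2) * cos (real (Suc p) * x) =
      sin (x / 2 + real (Suc p) * x) + sin (x / 2 - real (Suc p) * x)"
    using sin_times_cos[of "x / 2" "real (Suc p) * x"] by simp
  also have "x / 2 + real (Suc p) * x = (real (Suc p) + 1 / 2) * x"
    by (simp add: algebra_simps)
  also have "x / 2 - real (Suc p) * x = - ((real p + 1 / 2) * x)"
    by (simp add: algebra_simps)
  finally show ?case using Suc.IH by (simp add: distrib_left)
qed simp

text \<open>At \<open>x = 2 \<pi> m / (2 N - 1)\<close> the Dirichlet kernel with \<open>N - 1\<close> terms has the numerator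
  \<open>sin (\<pi> m) = 0\<close>, while its denominator vanishes only if \<open>2 N - 1\<close> divides \<open>m\<close>. The half weight at
  \<open>r = 0\<close> supplies the constant term of the kernel.\<close>

lemma weighted_cos_sum:
  fixes m :: int
  assumes N: "N \<ge> 1" and m: "\<bar>m\<bar> < 2 * int N - 1"
  shows "(\<Sum>r\<in>{0..int N - 1}. c_coeff N r * cos (2 * pi * of_int m * of_int r / (2 * real N - 1))) =
    (if m = 0 then (2 * real N - 1) / 2 else 0)"
proof -
  define x where "x = 2 * pi * of_int m / (2 * real N - 1)"
  have M: "2 * real N - 1 > 0" using N by simp
  have "(\<Sum>r\<in>{0..int N - 1}. c_coeff N r * cos (2 * pi * of_int m * of_int r / (2 * real N - 1))) =
    (\<Sum>r\<in>{0..<N}. c_coeff N (int r) * cos (real r * x))"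
    by (rule sum.reindex_bij_witness[of _ int nat]) (auto simp: x_def mult_ac)
  also have "\<dots> = 1 / 2 + (\<Sum>r\<in>{1..<N}. cos (real r * x))"
    using N by (subst sum.atLeast_Suc_lessThan) (auto simp: c_coeff_def intro!: sum.cong)
  also have "\<dots> = (if m = 0 then (2 * real N - 1) / 2 else 0)"
  proof (cases "m = 0")
    case True
    then show ?thesis using N by (simp add: x_def of_nat_diff field_simps)
  next
    case False
    have "sin (x / 2) \<noteq> 0"
    proof
      assume "sin (x / 2) = 0"
      then obtain i :: int where "x / 2 = of_int i * pi" by (auto simp: sin_zero_iff_int2)
      then have "pi * real_of_int m = pi * (of_int i * (2 * real N - 1))"
        using M by (simp add: x_def divide_eq_eq) (simp add: algebra_simps)
      then have "real_of_int m = of_int i * (2 * real N - 1)" by simp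
      then have "real_of_int m = real_of_int (i * (2 * int N - 1))" by simp
      then have im: "m = i * (2 * int N - 1)" by (simp only: of_int_eq_iff)
      with False have "\<bar>i\<bar> \<ge> 1" by auto
      then have "\<bar>i\<bar> * \<bar>2 * int N - 1\<bar> \<ge> 1 * \<bar>2 * int N - 1\<bar>" by (intro mult_right_mono) auto
      then show False using m im N by (simp add: abs_mult)
    qed
    moreover have "2 * sin (x / 2) * (1 / 2 + (\<Sum>r\<in>{1..<N}. cos (real r * x))) = 0"
    proof -
      have "(real (N - 1) + 1 / 2) * x = pi * of_int m"
        using N M by (simp add: x_def of_nat_diff field_simps)
      then show ?thesis using dirichlet_kernel_sin[of x "N - 1"] N by simp
    qed
    ultimately show ?thesis using False by simp
  qed
  finally show ?thesis .
qed

definition cos_kernel :: "nat \<Rightarrow> int \<Rightarrow> int \<Rightarrow> real" where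
  "cos_kernel N a b = cos (2 * pi * of_int a * of_int b / (2 * real N - 1))"

lemma cos_kernel_commute: "cos_kernel N a b = cos_kernel N b a"
  by (simp add: cos_kernel_def mult_ac)

text \<open>The frequency \<open>a - b\<close> contributes for \<open>a = b\<close>, and \<open>a + b\<close> only for \<open>a = b = 0\<close>; the latter
  doubles the norm, which the factor \<open>1 / c_coeff N a\<close> records.\<close>

lemma cos_kernel_orthogonality:
  assumes N: "N \<ge> 1" and a: "a \<in> {0..int N - 1}" and b: "b \<in> {0..int N - 1}"
  shows "(\<Sum>m\<in>{0..int N - 1}. c_coeff N m * cos_kernel N a m * cos_kernel N b m) =
    (if a = b then (2 * real N - 1) / 4 / c_coeff N a else 0)"
proof -
  have "(\<Sum>m\<in>{0..int N - 1}. c_coeff N m * cos_kernel N a m * cos_kernel N b m) =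
    (\<Sum>m\<in>{0..int N - 1}.
      c_coeff N m * cos (2 * pi * of_int (a - b) * of_int m / (2 * real N - 1)) +
      c_coeff N m * cos (2 * pi * of_int (a + b) * of_int m / (2 * real N - 1))) / 2"
    unfolding sum_divide_distrib
  proof (rule sum.cong[OF refl])
    fix m
    have "cos_kernel N a m * cos_kernel N b m =
      (cos (2 * pi * of_int (a - b) * of_int m / (2 * real N - 1)) +
       cos (2 * pi * of_int (a + b) * of_int m / (2 * real N - 1))) / 2"
      unfolding cos_kernel_def cos_times_cos
      by (simp add: diff_divide_distrib add_divide_distrib algebra_simps)
    then show "c_coeff N m * cos_kernel N a m * cos_kernel N b m =
      (c_coeff N m * cos (2 * pi * of_int (a - b) * of_int m / (2 * real N - 1)) +
      c_coeff N m * cos (2 * pi * of_int (a + b) * of_int m / (2 * real N - 1))) / 2"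
      by (simp add: algebra_simps)
  qed
  also have "\<dots> = ((if a - b = 0 then (2 * real N - 1) / 2 else 0) +
      (if a + b = 0 then (2 * real N - 1) / 2 else 0)) / 2"
    unfolding sum.distrib using a b N by (subst (1 2) weighted_cos_sum) auto
  also have "\<dots> = (if a = b then (2 * real N - 1) / 4 / c_coeff N a else 0)"
    using a b by (auto simp: c_coeff_def)
  finally show ?thesis .
qed

section \<open>The antisymmetric transform\<close>

lemma D_minus_eq: "D_minus n N = decreasing_labels n {0..int N - 1}"
  by (simp add: D_minus_def D_set_def decreasing_labels_def)

lemma antisym_cos_grid_point:
  "antisym_cos n (\<lambda>i. of_int (k i)) (grid_point n N r) = alternant n (cos_kernel N) k r"
  unfolding antisym_cos_def alternant_def
  by (intro sum.cong refl arg_cong2[where f="(*)"] prod.cong)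
     (simp add: grid_point_def cos_kernel_def mult_ac)

lemma alternant_cos_kernel_commute:
  "alternant n (cos_kernel N) k r = alternant n (cos_kernel N) r k"
  by (subst alternant_transpose) (simp add: alternant_def cos_kernel_commute)

lemma d_coeff_nonzero: "d_coeff n N k \<noteq> 0"
  by (simp add: d_coeff_def c_coeff_def)

lemma discrete_orthogonality:
  assumes N: "N \<ge> 1" and k: "k \<in> D_minus n N" and k': "k' \<in> D_minus n N"
  shows "(\<Sum>r\<in>D_minus n N. d_coeff n N r * alternant n (cos_kernel N) k r
           * alternant n (cos_kernel N) k' r) =
    inverse (d_coeff n N k) * ((2 * real N - 1) / 4) ^ n * (if k = k' then 1 else 0)"
proof -
  have "(\<Prod>i\<in>{1..n}. (2 * real N - 1) / 4 / c_coeff N (k i)) =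
      inverse (d_coeff n N k) * ((2 * real N - 1) / 4) ^ n"
    unfolding d_coeff_def prod_dividef by (simp add: inverse_eq_divide power_divide)
  moreover have "(\<Sum>r\<in>D_minus n N. d_coeff n N r * alternant n (cos_kernel N) k r
           * alternant n (cos_kernel N) k' r) =
      (if k = k' then \<Prod>i\<in>{1..n}. (2 * real N - 1) / 4 / c_coeff N (k i) else 0)"
    unfolding D_minus_eq d_coeff_def
    by (intro alternant_orthogonality[where B = "{0..int N - 1}"] cos_kernel_orthogonality N
        k[unfolded D_minus_eq] k'[unfolded D_minus_eq]) simp
  ultimately show ?thesis by (cases "k = k'") (simp_all only: simp_thms if_True if_False mult_1_right mult_zero_right)
qed

lemma sum_F_grid: "(\<Sum>s\<in>F_grid n N. g s) = (\<Sum>r\<in>D_minus n N. g (grid_point n N r))"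
  unfolding F_grid_def by (simp add: sum.reindex[OF inj_on_grid_point])

lemma weight_grid_point:
  "r \<in> D_minus n N \<Longrightarrow> grid_weight n N (grid_point n N r) = d_coeff n N r"
  by (simp add: grid_weight_grid_point d_coeff_def)

theorem mainTheorem1:
  fixes n N :: nat
  assumes "n \<ge> 1" and "N \<ge> 1"
  shows "(\<forall>k\<in>D_minus n N. \<forall>k'\<in>D_minus n N.
            (\<Sum>s\<in>F_grid n N. grid_weight n N s * antisym_cos n (\<lambda>i. of_int (k i)) s
                              * antisym_cos n (\<lambda>i. of_int (k' i)) s)
            = inverse (d_coeff n N k) * ((2 * real N - 1) / 4) ^ n * (if k = k' then 1 else 0))
       \<and> (\<forall>f :: (nat \<Rightarrow> real) \<Rightarrow> real. \<forall>s\<in>F_grid n N.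
            f s = (\<Sum>k\<in>D_minus n N.
              (d_coeff n N k * (4 / (2 * real N - 1)) ^ n
                 * (\<Sum>t\<in>F_grid n N. grid_weight n N t * f t * antisym_cos n (\<lambda>i. of_int (k i)) t))
              * antisym_cos n (\<lambda>i. of_int (k i)) s))"
proof (intro conjI ballI allI)
  fix k k' assume "k \<in> D_minus n N" "k' \<in> D_minus n N"
  then show "(\<Sum>s\<in>F_grid n N. grid_weight n N s * antisym_cos n (\<lambda>i. of_int (k i)) s
                              * antisym_cos n (\<lambda>i. of_int (k' i)) s)
            = inverse (d_coeff n N k) * ((2 * real N - 1) / 4) ^ n * (if k = k' then 1 else 0)"
    using discrete_orthogonality[OF \<open>N \<ge> 1\<close>, of k n k']
    by (simp add: sum_F_grid weight_grid_point antisym_cos_grid_point)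
next
  fix f :: "(nat \<Rightarrow> real) \<Rightarrow> real" and s assume "s \<in> F_grid n N"
  then obtain q where q: "q \<in> D_minus n N" and s: "s = grid_point n N q"
    by (auto simp: F_grid_def)
  let ?D = "D_minus n N" and ?d = "d_coeff n N" and ?A = "alternant n (cos_kernel N)"
  let ?f = "\<lambda>r. f (grid_point n N r)" and ?M = "2 * real N - 1"
  have M: "?M > 0" using \<open>N \<ge> 1\<close> by simp
  have fin: "finite ?D" by (simp add: D_minus_def D_set_def finite_PiE)
  have "(\<Sum>k\<in>?D. (?d k * (4 / ?M) ^ n
         * (\<Sum>t\<in>F_grid n N. grid_weight n N t * f t * antisym_cos n (\<lambda>i. of_int (k i)) t))
         * antisym_cos n (\<lambda>i. of_int (k i)) s) =
      (\<Sum>k\<in>?D. (?d k * (4 / ?M) ^ n * (\<Sum>r\<in>?D. ?d r * ?f r * ?A k r)) * ?A k q)"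
    by (simp add: s sum_F_grid weight_grid_point antisym_cos_grid_point)
  also have "\<dots> = (\<Sum>k\<in>?D. \<Sum>r\<in>?D. (4 / ?M) ^ n * ?d r * ?f r * (?d k * ?A r k * ?A q k))"
    unfolding sum_distrib_left sum_distrib_right
  proof (intro sum.cong refl)
    fix k r
    show "?d k * (4 / ?M) ^ n * (?d r * ?f r * ?A k r) * ?A k q =
        (4 / ?M) ^ n * ?d r * ?f r * (?d k * ?A r k * ?A q k)"
      by (simp only: alternant_cos_kernel_commute[of n N k] mult_ac)
  qed
  also have "\<dots> = (\<Sum>r\<in>?D. (4 / ?M) ^ n * ?d r * ?f r * (\<Sum>k\<in>?D. ?d k * ?A r k * ?A q k))"
    by (subst sum.swap) (simp add: sum_distrib_left)
  also have "\<dots> = (\<Sum>r\<in>?D. if r = q then ?f r else 0)"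
  proof (rule sum.cong[OF refl])
    fix r assume r: "r \<in> ?D"
    have "(4 / ?M) ^ n * (?M / 4) ^ n = 1"
      using M by (simp flip: power_mult_distrib)
    moreover have "?d r * inverse (?d r) = 1" by (simp add: d_coeff_nonzero)
    moreover have "(4 / ?M) ^ n * ?d r * ?f r * (inverse (?d r) * (?M / 4) ^ n) =
        ((4 / ?M) ^ n * (?M / 4) ^ n) * (?d r * inverse (?d r)) * ?f r"
      by (simp only: mult_ac)
    ultimately have "(4 / ?M) ^ n * ?d r * ?f r * (inverse (?d r) * (?M / 4) ^ n) = ?f r"
      by simp
    then show "(4 / ?M) ^ n * ?d r * ?f r * (\<Sum>k\<in>?D. ?d k * ?A r k * ?A q k) =
        (if r = q then ?f r else 0)"
      unfolding discrete_orthogonality[OF \<open>N \<ge> 1\<close> r q]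
      by (cases "r = q") (simp_all only: simp_thms if_True if_False mult_1_right mult_zero_right)
  qed
  also have "\<dots> = f s" using q fin by (simp add: s)
  finally show "f s = (\<Sum>k\<in>?D. (?d k * (4 / ?M) ^ n
         * (\<Sum>t\<in>F_grid n N. grid_weight n N t * f t * antisym_cos n (\<lambda>i. of_int (k i)) t))
         * antisym_cos n (\<lambda>i. of_int (k i)) s)" by simp
qed

end
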